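(* Let $m,k$ be positive integers with $k\ge 3$. If $k>m$, then $\chi(mk,k)=2$.
   Context: For positive integers $k,N,d$ with $k\ge 3$, a $k$-term cyclic arithmetic progression mod $N$ with common difference $d$ is a $k$-element subset of $\mathbb{Z}_N=\mathbb{Z}/N\mathbb{Z}$ of the form $\{t,t+d,\ldots,t+(k-1)d\}$ for some $t\in\mathbb{Z}_N$ (so these $k$ elements are pairwise distinct mod $N$). $\chi(N,k)$ denotes the minimum number of subsets necessary to partition $\mathbb{Z}_N$ such that no subset in the partition contains any $k$-term cyclic arithmetic progression mod $N$. *)

theory Defs
  imports Main "HOL-Library.Disjoint_Sets"
begin

(* The elements of Z_N are represented by their least nonnegative residues {0..<N}. *)

definition cyclic_ap :: "nat \<Rightarrow> nat \<Rightarrow> nat \<Rightarrow> nat set \<Rightarrow> bool" where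
  "cyclic_ap N k d A \<longleftrightarrow>
     0 < d \<and> card A = k \<and> (\<exists>t\<in>{0..<N}. A = (\<lambda>i. (t + i * d) mod N) ` {0..<k})"

definition ap_free :: "nat \<Rightarrow> nat \<Rightarrow> nat set \<Rightarrow> bool" where
  "ap_free N k S \<longleftrightarrow> \<not> (\<exists>d A. cyclic_ap N k d A \<and> A \<subseteq> S)"

(* For N \<ge> 1 and k \<ge> 2 the partition into singletons is admissible,
   so the minimum is attained. *)
definition chi :: "nat \<Rightarrow> nat \<Rightarrow> nat" where
  "chi N k = (LEAST r. \<exists>P. partition_on {0..<N} P \<and> card P = r \<and> (\<forall>S\<in>P. ap_free N k S))"

end

theory Submission
  imports Defs "HOL-Number_Theory.Cong"
begin

text \<open>Colour a residue modulo \<open>m * k\<close> by whether its residue modulo \<open>k\<close> lies in the lower half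
  \<open>{0..<k div 2}\<close>. A progression with \<open>k > m\<close> distinct terms has a difference \<open>d\<close> that is not a
  multiple of \<open>k\<close>, so \<open>e = gcd d k\<close> is a proper divisor of \<open>k\<close> and thus \<open>e \<le> k div 2\<close>. Modulo \<open>k\<close>
  the progression fills a whole coset of the multiples of \<open>e\<close>, which meets every interval of
  length \<open>e\<close>, in particular both halves.\<close>

text \<open>By Bezout some multiple of \<open>d\<close> is congruent to \<open>gcd d k\<close>
  modulo \<open>k\<close>; scaling it covers any offset \<open>r - t\<close> divisible by that
  gcd.\<close>

lemma ap_hits_residue:
  fixes t d k r :: nat
  assumes "k > 0" and "[r = t] (mod gcd d k)"
  shows "\<exists>i<k. [t + i * d = r] (mod k)"
proof -
  obtain x where x: "[int d * x = gcd (int d) (int k)] (mod int k)"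
    using cong_solve_int by blast
  have "[int r = int t] (mod gcd (int d) (int k))"
    using assms(2) by (simp flip: cong_int_iff)
  then obtain q where q: "int r = int t + gcd (int d) (int k) * q"
    by (metis cong_iff_lin cong_sym)
  \<comment> \<open>The integer multiplier \<open>x * q\<close> may be negative; its residue modulo
    \<open>k\<close> is a valid index below \<open>k\<close>.\<close>
  define i where "i = nat ((x * q) mod int k)"
  have i: "int i = (x * q) mod int k" and "i < k"
    using assms(1) by (auto simp: i_def nat_less_iff)
  have "[int i = x * q] (mod int k)"
    by (simp add: i cong_def)
  then have "[int t + int i * int d = int t + (x * q) * int d] (mod int k)"
    by (intro cong_add cong_mult cong_refl)
  also have "int t + (x * q) * int d = int t + (int d * x) * q"
    by (simp add: algebra_simps)
  also have "[int t + (int d * x) * q = int t + gcd (int d) (int k) * q] (mod int k)"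
    using x by (intro cong_add cong_mult cong_refl)
  finally have "[int (t + i * d) = int r] (mod int k)"
    by (simp add: q)
  then show ?thesis
    using \<open>i < k\<close> unfolding cong_int_iff by blast
qed

lemma ap_hits_both_halves:
  fixes t d k :: nat
  assumes "k > 0" and "\<not> k dvd d"
  shows "\<exists>i<k. (t + i * d) mod k < k div 2"
    and "\<exists>i<k. \<not> (t + i * d) mod k < k div 2"
proof -
  define e where "e = gcd d k"
  have "e > 0" "e dvd k" using assms(1) by (simp_all add: e_def)
  have "e \<noteq> k" using assms(2) unfolding e_def by (metis gcd_dvd1)
  from \<open>e dvd k\<close> obtain c where c: "k = e * c" ..
  then have "c \<noteq> 1" using \<open>e \<noteq> k\<close> by auto
  moreover have "c \<noteq> 0" using c assms(1) by auto
  ultimately have "c \<ge> 2" by simp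
  then have "e * 2 \<le> k" unfolding c by (rule mult_le_mono2)
  then have e: "e \<le> k div 2" by simp
  \<comment> \<open>\<open>s\<close> represents the class of \<open>t\<close> modulo
    \<open>e\<close> in the bottom interval \<open>{0..<e}\<close>, which lies in the lower
    half.\<close>
  define s where "s = t mod e"
  have s: "s < e" "[s = t] (mod e)"
    using \<open>e > 0\<close> by (auto simp: s_def)
  obtain i where i: "i < k" "[t + i * d = s] (mod k)"
    using ap_hits_residue[of k s t d] s assms(1) by (auto simp: e_def)
  have "(t + i * d) mod k = s"
    using i(2) s(1) e assms(1) by (simp add: cong_def)
  then show "\<exists>i<k. (t + i * d) mod k < k div 2"
    using i(1) s(1) e by auto
  \<comment> \<open>Shifting \<open>s\<close> by \<open>k - e\<close>, a multiple of
    \<open>e\<close>, gives the representative in the top interval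
    \<open>{k - e..<k}\<close>.\<close>
  have "k - e + s = s + e * (c - 1)"
    using c by (simp add: diff_mult_distrib2)
  then have "[k - e + s = t] (mod e)"
    using s(2) by (simp add: cong_def)
  then obtain j where j: "j < k" "[t + j * d = k - e + s] (mod k)"
    using ap_hits_residue[of k "k - e + s" t d] assms(1) by (auto simp: e_def)
  have "(t + j * d) mod k = k - e + s"
    using j(2) s(1) e assms(1) by (simp add: cong_def)
  moreover have "\<not> k - e + s < k div 2"
    using e by linarith
  ultimately show "\<exists>i<k. \<not> (t + i * d) mod k < k div 2"
    using j(1) by auto
qed

text \<open>If \<open>k\<close> divides \<open>d\<close>, then \<open>m * k\<close> divides
  \<open>m * d\<close>, so the terms repeat with period \<open>m\<close> in the index and at most
  \<open>m < k\<close> of them are distinct.\<close>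

lemma cyclic_ap_not_dvd:
  assumes "cyclic_ap (m * k) k d A" and "m \<ge> 1" and "k > m"
  shows "\<not> k dvd d"
proof
  assume "k dvd d"
  then obtain c where d: "d = k * c" by blast
  obtain t where A: "A = (\<lambda>i. (t + i * d) mod (m * k)) ` {0..<k}" and "card A = k"
    using assms(1) by (auto simp: cyclic_ap_def)
  have "(t + i * d) mod (m * k) = (t + (i mod m) * d) mod (m * k)" for i
  proof -
    have "t + i * d = t + (i mod m + m * (i div m)) * d" by simp
    also have "\<dots> = t + (i mod m) * d + (m * k) * (i div m * c)"
      unfolding d by (simp only: algebra_simps)
    finally show ?thesis by (metis mod_mult_self2)
  qed
  then have "A \<subseteq> (\<lambda>i. (t + i * d) mod (m * k)) ` {0..<m}"
    using assms(2) unfolding A by fastforce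
  then have "card A \<le> m"
    by (metis card_atLeastLessThan diff_zero finite_atLeastLessThan surj_card_le)
  then show False using \<open>card A = k\<close> assms(3) by simp
qed

lemma ap_free_halves:
  assumes "m \<ge> 1" and "k > m"
  shows "ap_free (m * k) k {x \<in> {0..<m * k}. x mod k < k div 2}"
    and "ap_free (m * k) k {x \<in> {0..<m * k}. \<not> x mod k < k div 2}"
proof -
  have *: "(\<exists>x\<in>A. x mod k < k div 2) \<and> (\<exists>x\<in>A. \<not> x mod k < k div 2)"
    if ap: "cyclic_ap (m * k) k d A" for d A
  proof -
    obtain t where A: "A = (\<lambda>i. (t + i * d) mod (m * k)) ` {0..<k}"
      using ap by (auto simp: cyclic_ap_def)
    have "k > 0" using assms by simp
    \<comment> \<open>As \<open>k\<close> divides \<open>m * k\<close>, reducing a term modulo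
      \<open>m * k\<close> preserves its residue modulo \<open>k\<close>.\<close>
    then show ?thesis
      using ap_hits_both_halves[OF _ cyclic_ap_not_dvd[OF ap assms], of t]
      by (simp add: A mod_mod_cancel Bex_def)
  qed
  show "ap_free (m * k) k {x \<in> {0..<m * k}. x mod k < k div 2}"
    and "ap_free (m * k) k {x \<in> {0..<m * k}. \<not> x mod k < k div 2}"
    unfolding ap_free_def using * by blast+
qed

text \<open>The progression 0, 1, ..., \<open>k - 1\<close> is a witness; this excludes a partition
  with a single class.\<close>

lemma not_ap_free_residues:
  assumes "0 < k" and "k \<le> N"
  shows "\<not> ap_free N k {0..<N}"
proof -
  have "(\<lambda>i. (0 + i * 1) mod N) ` {0..<k} = {0..<k}"
    using assms by (auto simp: image_iff)
  then have "cyclic_ap N k 1 {0..<k}"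
    unfolding cyclic_ap_def using assms by (auto intro!: bexI[of _ 0])
  then show ?thesis
    unfolding ap_free_def using assms(2) by (meson ivl_subset order_refl)
qed

theorem proposition4p1:
  fixes m k :: nat
  assumes "m \<ge> 1" and "k \<ge> 3" and "k > m"
  shows "chi (m * k) k = 2"
  unfolding chi_def
proof (rule Least_equality)
  let ?N = "m * k"
  let ?L = "{x \<in> {0..<?N}. x mod k < k div 2}"
  let ?U = "{x \<in> {0..<?N}. \<not> x mod k < k div 2}"
  have "k \<le> ?N" using assms(1) by simp
  \<comment> \<open>The elements 0 and \<open>k div 2\<close> show that both classes are nonempty,
    as \<open>partition_on\<close> demands of its blocks.\<close>
  then have "0 < k div 2" "k div 2 < k" "k div 2 < ?N" using assms(2) by linarith+
  then have "0 \<in> ?L" "k div 2 \<in> ?U" using assms(1) by auto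
  then have "?L \<noteq> {}" "?U \<noteq> {}" by blast+
  moreover have "?L \<inter> ?U = {}" "?L \<union> ?U = {0..<?N}" by blast+
  ultimately have "partition_on {0..<?N} {?L, ?U}" "?L \<noteq> ?U"
    by (auto simp: partition_on_def disjoint_def)
  then show "\<exists>P. partition_on {0..<?N} P \<and> card P = 2 \<and> (\<forall>S\<in>P. ap_free ?N k S)"
    using ap_free_halves[OF assms(1,3)] by (intro exI[of _ "{?L, ?U}"]) auto
next
  fix r
  assume "\<exists>P. partition_on {0..<m * k} P \<and> card P = r \<and> (\<forall>S\<in>P. ap_free (m * k) k S)"
  then obtain P where P: "partition_on {0..<m * k} P" "card P = r"
    and free: "\<forall>S\<in>P. ap_free (m * k) k S" by blast
  \<comment> \<open>Since \<open>card\<close> is 0 on infinite sets, finiteness is needed to exclude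
    \<open>r = 0\<close>.\<close>
  have "finite P" using P(1) finite_elements by blast
  have union: "\<Union> P = {0..<m * k}" using P(1) by (simp add: partition_on_def)
  have "P \<noteq> {}" using union assms by auto
  then have "r \<noteq> 0" using P(2) \<open>finite P\<close> by auto
  moreover have "r \<noteq> 1"
  proof
    assume "r = 1"
    then obtain S where "P = {S}" using P(2) card_1_singletonE by blast
    then have "ap_free (m * k) k {0..<m * k}" using union free by simp
    then show False using not_ap_free_residues[of k "m * k"] assms by simp
  qed
  ultimately show "2 \<le> r" by simp
qed

end
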